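(* Let $m,k\ge1$, $f\in\mathbb{Q}^m\setminus\mathbb{Z}^m$, $r^1,\dots,r^k\in\mathbb{Q}^m\setminus\{0\}$, assume $X=\{(x,s)\in\mathbb{Z}^m\times\mathbb{R}^k_+ : x=f+\sum_j r^js_j\}\neq\emptyset$, and let $P=\{(x,s)\in\mathbb{R}^m\times\mathbb{R}^k_+ : x=f+\sum_j r^js_j\}$. Let $L$ be a rational lattice-free polytope in $\mathbb{R}^m$ containing $f$ in its interior. If $L$ has the 2-hyperplane property, then the $L$-cut $\sum_j\psi(r^j)s_j\ge1$ has finite split rank with respect to $P$.
   Context: Lattice-free: no integer point in the interior. $\psi(r)=\inf\{t>0: r/t\in L-f\}$. A split is $(\pi,\pi_0)$, $\pi\in\mathbb{Z}^m$, $\pi_0\in\mathbb{Z}$, acting on $x$, with boundary hyperplanes $\{\pi x=\pi_0\}$, $\{\pi x=\pi_0+1\}$. For a polyhedron $Q$, $Q(\pi,\pi_0)=\mathrm{conv}((Q\cap\{\pi x\le\pi_0\})\cup(Q\cap\{\pi x\ge\pi_0+1\}))$; split closure = intersection of all $Q(\pi,\pi_0)$; rank-$t$ split closure iteratively (rank 0 is $Q$). Split rank of a valid inequality w.r.t. $Q$: least $t$ such that it is valid for the rank-$t$ split closure, or $+\infty$. A set of points is 2-partitionable if it has at most one element or can be partitioned into two nonempty sets lying respectively on the two boundary hyperplanes of some split. $L_I$ is the convex hull of integer points of $L$; $L$ has the 2-hyperplane property if every face of $L_I$ not contained in a facet of $L$ has a 2-partitionable set of integer points. *)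

theory Defs
  imports "HOL-Analysis.Analysis"
begin

definition int_vec :: "real^'m \<Rightarrow> bool" where
  "int_vec x \<longleftrightarrow> (\<forall>i. x $ i \<in> \<int>)"

definition rat_vec :: "real^'m \<Rightarrow> bool" where
  "rat_vec x \<longleftrightarrow> (\<forall>i. x $ i \<in> \<rat>)"

definition integer_points :: "(real^'m) set \<Rightarrow> (real^'m) set" where
  "integer_points S = {x \<in> S. int_vec x}"

definition rational_polytope :: "(real^'m) set \<Rightarrow> bool" where
  "rational_polytope L \<longleftrightarrow> (\<exists>V. finite V \<and> (\<forall>v\<in>V. rat_vec v) \<and> L = convex hull V)"

definition lattice_free :: "(real^'m) set \<Rightarrow> bool" where
  "lattice_free L \<longleftrightarrow> (\<forall>x \<in> interior L. \<not> int_vec x)"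

definition psi :: "(real^'m) set \<Rightarrow> real^'m \<Rightarrow> real^'m \<Rightarrow> real" where
  "psi L f r = Inf {t::real. t > 0 \<and> (inverse t) *\<^sub>R r \<in> (\<lambda>y. y - f) ` L}"

definition split_set :: "((real^'m) \<times> (real^'k)) set \<Rightarrow> real^'m \<Rightarrow> int \<Rightarrow> ((real^'m) \<times> (real^'k)) set" where
  "split_set Q a c0 = convex hull
     ((Q \<inter> {(x,s). a \<bullet> x \<le> of_int c0}) \<union> (Q \<inter> {(x,s). a \<bullet> x \<ge> of_int c0 + 1}))"

definition split_closure :: "((real^'m) \<times> (real^'k)) set \<Rightarrow> ((real^'m) \<times> (real^'k)) set" where
  "split_closure Q = (\<Inter>{split_set Q a c0 | a c0. int_vec a})"

definition rank_split_closure :: "nat \<Rightarrow> ((real^'m) \<times> (real^'k)) set \<Rightarrow> ((real^'m) \<times> (real^'k)) set" where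
  "rank_split_closure t Q = (split_closure ^^ t) Q"

definition finite_split_rank :: "('k::finite \<Rightarrow> real) \<Rightarrow> ((real^'m) \<times> (real^'k)) set \<Rightarrow> bool" where
  "finite_split_rank c Q \<longleftrightarrow>
     (\<exists>t. \<forall>(x,s) \<in> rank_split_closure t Q. (\<Sum>j\<in>UNIV. c j * s $ j) \<ge> 1)"

definition two_partitionable :: "(real^'m) set \<Rightarrow> bool" where
  "two_partitionable S \<longleftrightarrow> S = {} \<or> (\<exists>a. S = {a}) \<or>
     (\<exists>A B a (c0::int). A \<noteq> {} \<and> B \<noteq> {} \<and> A \<union> B = S \<and> A \<inter> B = {} \<and> int_vec a \<and>
        A \<subseteq> {x. a \<bullet> x = of_int c0} \<and> B \<subseteq> {x. a \<bullet> x = of_int c0 + 1})"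

definition integer_hull :: "(real^'m) set \<Rightarrow> (real^'m) set" where
  "integer_hull L = convex hull (integer_points L)"

definition two_hyperplane_property :: "(real^'m) set \<Rightarrow> bool" where
  "two_hyperplane_property L \<longleftrightarrow>
     (\<forall>F. F face_of integer_hull L \<and> \<not> (\<exists>G. G facet_of L \<and> F \<subseteq> G)
          \<longrightarrow> two_partitionable (integer_points F))"

end

theory Submission
  imports Defs
begin

text \<open>
  Call \<open>z = 1 - (\<Sum>j. psi L f (r j) * s j)\<close> the height of \<open>(x, s)\<close>; the cut says \<open>z \<le> 0\<close>.  On \<open>P\<close> we have
  \<open>z \<le> 1 - g \<bullet> (x - f)\<close> for every \<open>g\<close> in the polar of \<open>L - f\<close>, and in particular \<open>z \<le> 1\<close>.  It
  suffices to find \<open>K\<close> and \<open>N\<close> such that \<open>N\<close> rounds of split closure always lower a bound \<open>z \<le> M + 1 / K\<close>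
  with \<open>M \<ge> 0\<close> to \<open>z \<le> M\<close>.  After rescaling to \<open>z' = K (z - M)\<close> one starts from \<open>z' \<le> 1\<close> and
  \<open>z' \<le> K (1 - g \<bullet> (x - f))\<close>, where the walls over the boundary of \<open>L\<close> are as steep as we like.

  For \<open>K\<close> large, the affine functions that may be added to the right-hand side of any reachable
  inequality \<open>z' \<le> b - a \<bullet> x\<close> form a cone that contains the inequalities of \<open>L\<close> and is closed under
  Chvatal rounding, so it contains all integral inequalities valid for the integer points of \<open>L\<close>.
  Then, by induction on the number of integer points on the face of the integer hull where
  the integral function \<open>k - a \<bullet> x \<ge> 0\<close> vanishes, some multiple of it is a reachable bound for \<open>z'\<close>: if
  the face lies in a facet of \<open>L\<close>, the steep wall over that facet gives this; otherwise the face
  is 2-partitionable, and the splitting disjunction leaves the two smaller faces given by the two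
  parts.  The zero function, whose face is the whole integer hull, yields \<open>z' \<le> 0\<close>.
\<close>

subsection \<open>Integral vectors\<close>

lemma int_vec_axis [simp]: "int_vec (axis i 1)"
  by (auto simp: int_vec_def axis_def)

lemma int_vec_0 [simp]: "int_vec 0"
  by (simp add: int_vec_def)

lemma int_vec_add: "int_vec x \<Longrightarrow> int_vec y \<Longrightarrow> int_vec (x + y)"
  by (simp add: int_vec_def)

lemma int_vec_diff: "int_vec x \<Longrightarrow> int_vec y \<Longrightarrow> int_vec (x - y)"
  by (simp add: int_vec_def)

lemma int_vec_scaleR: "t \<in> \<int> \<Longrightarrow> int_vec x \<Longrightarrow> int_vec (t *\<^sub>R x)"
  by (simp add: int_vec_def)

lemma inner_int_vec: "int_vec x \<Longrightarrow> int_vec y \<Longrightarrow> x \<bullet> y \<in> \<int>"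
  by (auto simp: int_vec_def inner_vec_def intro!: Ints_sum Ints_mult)

subsection \<open>Cones of inequalities closed under Chvatal rounding\<close>

text \<open>The pair \<open>(a, b)\<close> stands for the inequality \<open>a \<bullet> x \<le> b\<close>.\<close>

locale rounding_cone =
  fixes C :: "((real^'m) \<times> real) set"
  assumes nonneg: "b \<ge> 0 \<Longrightarrow> (0, b) \<in> C"
    and add: "p \<in> C \<Longrightarrow> q \<in> C \<Longrightarrow> p + q \<in> C"
    and scale: "p \<in> C \<Longrightarrow> t \<ge> 0 \<Longrightarrow> t *\<^sub>R p \<in> C"
    and bounded_above: "\<exists>b. (a, b) \<in> C"
    and rounding: "int_vec a \<Longrightarrow> e > 0 \<Longrightarrow> (a, of_int k + 1 - e) \<in> C \<Longrightarrow> (a, of_int k) \<in> C"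
begin

lemma weaken: "(a, b) \<in> C \<Longrightarrow> b \<le> b' \<Longrightarrow> (a, b') \<in> C"
  using add[of "(a, b)" "(0, b' - b)"] nonneg[of "b' - b"] by simp

text \<open>\<open>(0, -1)\<close> is the inequality 0 <= -1; its absence from a cone serves as
  consistency throughout.\<close>

lemma inconsistent: "b < 0 \<Longrightarrow> (0, b) \<in> C \<Longrightarrow> (0, -1) \<in> C"
  using scale[of "(0, b)" "-1/b"] by simp

lemma inconsistent_all:
  assumes "(0, -1) \<in> C" shows "(a, b) \<in> C"
proof -
  obtain M where M: "(a, M) \<in> C" using bounded_above by blast
  have "(0, - \<bar>M - b\<bar>) \<in> C" using scale[OF assms, of "\<bar>M - b\<bar>"] by simp
  from add[OF M this] have "(a, M - \<bar>M - b\<bar>) \<in> C" by simp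
  then show ?thesis by (rule weaken) simp
qed

text \<open>An integer bound \<open>k\<close> on \<open>a\<close> and a bound \<open>M'\<close> on
  \<open>-a\<close> add up to \<open>(0, k + M')\<close>, so consistency keeps \<open>k\<close> from
  falling below \<open>-M'\<close>.\<close>

lemma least_integer_bound:
  assumes "(0, -1) \<notin> C"
  obtains k :: int where "(a, of_int k) \<in> C" "(a, of_int (k - 1)) \<notin> C"
proof -
  obtain M where M: "(a, M) \<in> C" using bounded_above by blast
  obtain M' where M': "(-a, M') \<in> C" using bounded_above by blast
  have lower: "- M' \<le> of_int k" if "(a, of_int k) \<in> C" for k :: int
  proof (rule ccontr)
    assume "\<not> - M' \<le> of_int k"
    moreover have "(0, of_int k + M') \<in> C" using add[OF that M'] by simp
    ultimately show False using inconsistent[of "of_int k + M'"] assms by auto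
  qed
  define z where "z = \<lceil>M\<rceil>"
  have top: "(a, of_int z) \<in> C" unfolding z_def by (rule weaken[OF M]) simp
  define n where "n = (LEAST n::nat. (a, of_int (z - int n)) \<notin> C)"
  have ex: "\<exists>n::nat. (a, of_int (z - int n)) \<notin> C"
  proof (rule ccontr)
    assume "\<not> ?thesis"
    then have "(a, of_int (z - int (nat (z + \<lceil>M'\<rceil> + 1)))) \<in> C" by blast
    from lower[OF this] lower[OF top] show False by linarith
  qed
  have n: "(a, of_int (z - int n)) \<notin> C" unfolding n_def by (rule LeastI_ex[OF ex])
  then obtain j where j: "n = Suc j" using top by (cases n) auto
  have "(a, of_int (z - int j)) \<in> C"
    using not_less_Least[of j "\<lambda>n. (a, of_int (z - int n)) \<notin> C"] j unfolding n_def by auto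
  moreover have "(a, of_int (z - int j - 1)) \<notin> C" using n j by (simp add: algebra_simps)
  ultimately show thesis by (rule that)
qed

end

text \<open>The cone modulo a tight inequality; geometrically, the restriction to the face on which
  that inequality is tight.  Rounding survives because the tight inequality is integral.\<close>

definition face_cone :: "((real^'m) \<times> real) set \<Rightarrow> (real^'m) \<times> real \<Rightarrow> ((real^'m) \<times> real) set" where
  "face_cone C h = {p. \<exists>n::nat. p + real n *\<^sub>R h \<in> C}"

lemma subset_face_cone: "C \<subseteq> face_cone C h"
  by (auto simp: face_cone_def intro!: exI[of _ 0])

context rounding_cone
begin

lemma rounding_cone_face_cone:
  assumes a: "int_vec a" and h: "(a, of_int k) \<in> C"
  shows "rounding_cone (face_cone C (a, of_int k))"
proof
  let ?h = "(a, of_int k) :: (real^'m) \<times> real"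
  show "(0, b) \<in> face_cone C ?h" if "b \<ge> 0" for b
    using subset_face_cone nonneg[OF that] by blast
  show "p + q \<in> face_cone C ?h" if p: "p \<in> face_cone C ?h" and q: "q \<in> face_cone C ?h" for p q
  proof -
    obtain n n' :: nat where "p + real n *\<^sub>R ?h \<in> C" "q + real n' *\<^sub>R ?h \<in> C"
      using p q unfolding face_cone_def by blast
    from add[OF this] have "(p + q) + real (n + n') *\<^sub>R ?h \<in> C"
      by (simp add: scaleR_add_left algebra_simps)
    then show ?thesis unfolding face_cone_def by blast
  qed
  show "t *\<^sub>R p \<in> face_cone C ?h" if p: "p \<in> face_cone C ?h" and t: "t \<ge> 0" for p t
  proof -
    obtain n :: nat where n: "p + real n *\<^sub>R ?h \<in> C" using p unfolding face_cone_def by blast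
    \<comment> \<open>A face cone admits natural multiples of the tight inequality; rounding
      \<open>t * real n\<close> up adds a nonnegative multiple of it, which lies in
      \<open>C\<close>.\<close>
    define n' where "n' = nat \<lceil>t * real n\<rceil>"
    have n': "t * real n \<le> real n'" unfolding n'_def by linarith
    have "t *\<^sub>R (p + real n *\<^sub>R ?h) + (real n' - t * real n) *\<^sub>R ?h \<in> C"
      using n' by (intro add scale n h t) auto
    also have "t *\<^sub>R (p + real n *\<^sub>R ?h) + (real n' - t * real n) *\<^sub>R ?h = t *\<^sub>R p + real n' *\<^sub>R ?h"
      by (simp only: scaleR_diff_left scaleR_add_right scaleR_scaleR) simp
    finally show ?thesis unfolding face_cone_def by blast
  qed
  show "\<exists>b. (v, b) \<in> face_cone C ?h" for v
    using subset_face_cone bounded_above by blast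
  show "(v, of_int j) \<in> face_cone C ?h"
    if v: "int_vec v" and e: "e > 0" and ve: "(v, of_int j + 1 - e) \<in> face_cone C ?h" for v e j
  proof -
    obtain n :: nat where "(v, of_int j + 1 - e) + real n *\<^sub>R ?h \<in> C"
      using ve unfolding face_cone_def by blast
    then have "(v + real n *\<^sub>R a, of_int (j + int n * k) + 1 - e) \<in> C"
      by (simp add: algebra_simps)
    moreover have "int_vec (v + real n *\<^sub>R a)"
      using v a by (intro int_vec_add int_vec_scaleR) auto
    ultimately have "(v + real n *\<^sub>R a, of_int (j + int n * k)) \<in> C"
      using e by (intro rounding)
    then show ?thesis unfolding face_cone_def by (auto intro!: exI[of _ n])
  qed
qed

text \<open>The face cone of the least integer bound \<open>k\<close> is consistent: otherwise
  \<open>(a, k - 1/n)\<close> would lie in \<open>C\<close> for some n > 0, and rounding would give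
  \<open>k - 1\<close>.\<close>

lemma tight_face:
  assumes "(0, -1) \<notin> C" "int_vec a"
  obtains D :: "((real^'m) \<times> real) set" and k :: int
  where "rounding_cone D" "C \<subseteq> D" "(0, -1) \<notin> D" "(a, of_int k) \<in> C" "(-a, - of_int k) \<in> D"
proof -
  obtain k :: int where k: "(a, of_int k) \<in> C" "(a, of_int (k - 1)) \<notin> C"
    using least_integer_bound[OF assms(1)] .
  let ?D = "face_cone C (a, of_int k)"
  have "(-a, - of_int k) \<in> ?D"
    unfolding face_cone_def using nonneg[of 0] by (auto intro!: exI[of _ 1] simp: zero_prod_def)
  moreover have "(0, -1) \<notin> ?D"
  proof
    assume "(0, -1) \<in> ?D"
    then obtain n :: nat where n: "(real n *\<^sub>R a, real n * of_int k - 1) \<in> C"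
      unfolding face_cone_def by auto
    have "n \<noteq> 0" using n assms(1) by (intro notI) simp
    then have "(a, of_int k - 1 / real n) \<in> C"
      using scale[OF n, of "1 / real n"] by (simp add: field_simps)
    then have "(a, of_int (k - 1)) \<in> C"
      using rounding[of a "1 / real n" "k - 1"] assms(2) \<open>n \<noteq> 0\<close> by simp
    then show False using k(2) by simp
  qed
  ultimately show thesis
    using that[OF rounding_cone_face_cone[OF assms(2) k(1)]] k subset_face_cone by blast
qed

text \<open>Passing to a tight face for one coordinate after another keeps the cone consistent and
  fixes an integer point \<open>p\<close>. Modulo these equations \<open>(a, b)\<close> becomes
  \<open>(0, b - a \<bullet> p)\<close>, so consistency bounds \<open>a \<bullet> p\<close> by
  \<open>b\<close>.\<close>

lemma integer_point_exists:
  assumes "(0, -1) \<notin> C"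
  obtains p where "int_vec p" "\<And>a b. (a, b) \<in> C \<Longrightarrow> a \<bullet> p \<le> b"
proof -
  have "\<exists>D. rounding_cone D \<and> C \<subseteq> D \<and> (0, -1) \<notin> D \<and>
      (\<forall>i\<in>S. \<exists>k::int. (axis i 1, of_int k) \<in> D \<and> (- axis i 1, - of_int k) \<in> D)"
    if "finite S" for S :: "'m set"
    using that
  proof induction
    case empty
    then show ?case using rounding_cone_axioms assms by blast
  next
    case (insert i S)
    then obtain D where D: "rounding_cone D" "C \<subseteq> D" "(0, -1) \<notin> D"
      "\<forall>i\<in>S. \<exists>k::int. (axis i 1, of_int k) \<in> D \<and> (- axis i 1, - of_int k) \<in> D" by blast
    obtain E :: "((real^'m) \<times> real) set" and k :: int
      where "rounding_cone E" "D \<subseteq> E" "(0, -1) \<notin> E"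
        "(axis i 1, of_int k) \<in> D" "(-axis i 1, - of_int k) \<in> E"
      using rounding_cone.tight_face[OF D(1,3) int_vec_axis] by blast
    then show ?case using D by (intro exI[of _ E]) blast
  qed
  from this[of UNIV] obtain D :: "((real^'m) \<times> real) set"
    where D: "rounding_cone D" "C \<subseteq> D" "(0, -1) \<notin> D"
      "\<forall>i. \<exists>k::int. (axis i 1, of_int k) \<in> D \<and> (- axis i 1, - of_int k) \<in> D" by auto
  interpret D: rounding_cone D by fact
  obtain k where k: "\<And>i. (axis i 1, of_int (k i)) \<in> D" "\<And>i. (- axis i 1, - of_int (k i)) \<in> D"
    using D(4) by metis
  define p :: "real^'m" where "p = (\<chi> i. of_int (k i))"
  have coord: "(- (t *\<^sub>R axis i 1), - (t * of_int (k i))) \<in> D" for t i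
    using D.scale[OF k(2), of t i] D.scale[OF k(1), of "-t" i] by (cases "t \<ge> 0") auto
  have neg: "(- a, - (a \<bullet> p)) \<in> D" for a
  proof -
    have "(\<Sum>i\<in>S. (- (a $ i *\<^sub>R axis i 1), - (a $ i * of_int (k i)))) \<in> D" if "finite S" for S
      using that by induction
        (use D.nonneg[of 0] in \<open>auto simp: zero_prod_def simp del: add_Pair intro!: D.add coord\<close>)
    from this[of UNIV] have "(- (\<Sum>i\<in>UNIV. a $ i *\<^sub>R axis i 1), - (\<Sum>i\<in>UNIV. a $ i * of_int (k i))) \<in> D"
      by (simp add: sum_prod sum_negf)
    then show ?thesis
      by (simp add: basis_expansion p_def inner_vec_def flip: scalar_mult_eq_scaleR)
  qed
  show thesis
  proof (rule that)
    show "int_vec p" by (simp add: p_def int_vec_def)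
    show "a \<bullet> p \<le> b" if "(a, b) \<in> C" for a b
    proof (rule ccontr)
      assume "\<not> a \<bullet> p \<le> b"
      moreover have "(0, b - a \<bullet> p) \<in> D" using D.add[OF _ neg, of "(a, b)" a] that D(2) by auto
      ultimately show False using D.inconsistent[of "b - a \<bullet> p"] D(3) by auto
    qed
  qed
qed

text \<open>Chvatal's theorem: once the bound on \<open>a \<bullet> x\<close> cannot be tightened any further, the face on which
  it is tight contains an integer point.\<close>

lemma integral_valid_mem:
  assumes a: "int_vec a"
    and valid: "\<And>p. int_vec p \<Longrightarrow> (\<forall>(c, d) \<in> C. c \<bullet> p \<le> d) \<Longrightarrow> a \<bullet> p \<le> of_int k"
  shows "(a, of_int k) \<in> C"
proof (cases "(0, -1) \<in> C")
  case True
  then show ?thesis by (rule inconsistent_all)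
next
  case False
  obtain D :: "((real^'m) \<times> real) set" and j :: int
    where D: "rounding_cone D" "C \<subseteq> D" "(0, -1) \<notin> D" "(a, of_int j) \<in> C" "(-a, - of_int j) \<in> D"
    using tight_face[OF False a] by blast
  obtain p where p: "int_vec p" "\<And>a b. (a, b) \<in> D \<Longrightarrow> a \<bullet> p \<le> b"
    using rounding_cone.integer_point_exists[OF D(1,3)] by blast
  have "a \<bullet> p \<le> of_int k" using p D(2) by (intro valid) auto
  moreover have "a \<bullet> p \<ge> of_int j" using p(2)[OF D(5)] by simp
  ultimately show ?thesis using weaken[OF D(4)] by simp
qed

end

subsection \<open>Integral normals of facets\<close>

lemma rat_vec_diff: "rat_vec x \<Longrightarrow> rat_vec y \<Longrightarrow> rat_vec (x - y)"
  by (simp add: rat_vec_def)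

lemma vector_space_rat_real: "vector_space (\<lambda>(q::rat) (x::real). of_rat q * x)"
  by unfold_locales (auto simp: of_rat_add of_rat_mult algebra_simps)

text \<open>Expand the coordinates of \<open>a\<close> in a basis over the rationals and perturb the basis elements
  to nearby rationals: linear relations with rational coefficients are preserved.\<close>

lemma rational_approx_orthogonal:
  fixes a :: "real^'m"
  assumes "e > 0"
  obtains a' where "rat_vec a'" "\<And>y. rat_vec y \<Longrightarrow> a \<bullet> y = 0 \<Longrightarrow> a' \<bullet> y = 0" "norm (a' - a) < e"
proof -
  interpret Q: vector_space "\<lambda>(q::rat) (x::real). of_rat q * x" by (rule vector_space_rat_real)
  obtain B where B: "B \<subseteq> range (($) a)" "\<not> Q.dependent B" "range (($) a) \<subseteq> Q.span B"
    using Q.maximal_independent_subset[of "range (($) a)"] by blast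
  have fin: "finite B" by (rule finite_subset[OF B(1)]) simp
  have "\<forall>i. \<exists>q. a $ i = (\<Sum>b\<in>B. of_rat (q b) * b)"
    using B(3) unfolding Q.span_finite[OF fin] by (auto simp: image_subset_iff image_iff)
  then obtain q where q: "\<And>i. a $ i = (\<Sum>b\<in>B. of_rat (q i b) * b)" by metis
  \<comment> \<open>The 1 makes \<open>M\<close> positive and the final estimate
    \<open>(M - 1) * (e / M) < e\<close> strict.\<close>
  define M where "M = (\<Sum>i\<in>UNIV. \<Sum>b\<in>B. \<bar>of_rat (q i b) :: real\<bar>) + 1"
  have Mpos: "M > 0" unfolding M_def by (simp add: add_nonneg_pos sum_nonneg)
  have "\<exists>c. c \<in> \<rat> \<and> \<bar>c - b\<bar> < e / M" for b :: real
  proof -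
    obtain c where "c \<in> \<rat>" "b < c" "c < b + e / M"
      using Rats_dense_in_real[of b "b + e / M"] assms Mpos by auto
    then show ?thesis by (intro exI[of _ c]) auto
  qed
  then obtain c where c: "\<And>b. c b \<in> \<rat>" "\<And>b. \<bar>c b - b\<bar> < e / M" by metis
  define a' :: "real^'m" where "a' = (\<chi> i. \<Sum>b\<in>B. of_rat (q i b) * c b)"
  show thesis
  proof (rule that)
    show "rat_vec a'" unfolding rat_vec_def a'_def by (auto intro!: Rats_sum Rats_mult c)
    show "a' \<bullet> y = 0" if y: "rat_vec y" "a \<bullet> y = 0" for y
    proof -
      have "\<forall>i. \<exists>p. y $ i = of_rat p" using y(1) by (auto simp: rat_vec_def Rats_def)
      then obtain p where p: "\<And>i. y $ i = of_rat (p i)" by metis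
      define s where "s b = (\<Sum>i\<in>UNIV. q i b * p i)" for b
      have expand: "(\<Sum>i\<in>UNIV. (\<Sum>b\<in>B. of_rat (q i b) * g b) * of_rat (p i)) = (\<Sum>b\<in>B. of_rat (s b) * g b)"
        for g :: "real \<Rightarrow> real"
        unfolding s_def of_rat_sum of_rat_mult sum_distrib_right
        by (subst sum.swap) (simp add: mult_ac)
      have "(\<Sum>b\<in>B. of_rat (s b) * b) = 0"
        using y(2) expand[of "\<lambda>b. b"] by (simp add: inner_vec_def p q)
      \<comment> \<open>Independence over the rationals kills every coefficient, so the relation
        survives whatever replaces the basis elements.\<close>
      then have "\<forall>b\<in>B. s b = 0" using B(2) fin unfolding Q.dependent_finite[OF fin] by blast
      then show ?thesis using expand[of c] by (simp add: inner_vec_def p a'_def)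
    qed
    have "norm (a' - a) \<le> (\<Sum>i\<in>UNIV. \<bar>(a' - a) $ i\<bar>)" by (rule norm_le_l1_cart)
    also have "\<dots> \<le> (\<Sum>i\<in>UNIV. \<Sum>b\<in>B. \<bar>of_rat (q i b)\<bar> * (e / M))"
    proof (rule sum_mono)
      fix i
      have "(a' - a) $ i = (\<Sum>b\<in>B. of_rat (q i b) * (c b - b))"
        by (simp add: a'_def q sum_subtractf right_diff_distrib)
      also have "\<bar>\<dots>\<bar> \<le> (\<Sum>b\<in>B. \<bar>of_rat (q i b) * (c b - b)\<bar>)" by (rule sum_abs)
      also have "\<dots> \<le> (\<Sum>b\<in>B. \<bar>of_rat (q i b)\<bar> * (e / M))"
        unfolding abs_mult by (intro sum_mono mult_left_mono less_imp_le[OF c(2)]) auto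
      finally show "\<bar>(a' - a) $ i\<bar> \<le> (\<Sum>b\<in>B. \<bar>of_rat (q i b)\<bar> * (e / M))" .
    qed
    also have "\<dots> = (\<Sum>i\<in>UNIV. \<Sum>b\<in>B. \<bar>of_rat (q i b)\<bar>) * (e / M)" by (simp only: sum_distrib_right)
    also have "\<dots> = (M - 1) * (e / M)" by (simp add: M_def)
    also have "\<dots> < e" using assms Mpos by (simp add: field_simps)
    finally show "norm (a' - a) < e" .
  qed
qed

lemma rat_vec_clear_denominators:
  fixes a :: "real^'m"
  assumes "rat_vec a"
  obtains d :: nat where "d > 0" "int_vec (real d *\<^sub>R a)"
proof -
  have "\<forall>i. \<exists>n::nat. n > 0 \<and> real n * a $ i \<in> \<int>"
  proof
    fix i
    have "a $ i \<in> \<rat>" using assms by (simp add: rat_vec_def)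
    then obtain m n where "n > 0" "a $ i = of_int m / of_int n" by (rule Rats_cases')
    then show "\<exists>n::nat. n > 0 \<and> real n * a $ i \<in> \<int>" by (intro exI[of _ "nat n"]) auto
  qed
  then obtain n where n: "\<And>i. n i > (0::nat)" "\<And>i. real (n i) * a $ i \<in> \<int>" by metis
  show thesis
  proof
    show "prod n UNIV > 0" using n by (simp add: prod_pos)
    show "int_vec (real (prod n UNIV) *\<^sub>R a)"
      unfolding int_vec_def
    proof
      fix i
      have "real (prod n UNIV) * a $ i = real (prod n (UNIV - {i})) * (real (n i) * a $ i)"
        by (subst prod.remove[of UNIV i]) auto
      also have "\<dots> \<in> \<int>" by (intro Ints_mult n) auto
      finally show "(real (prod n UNIV) *\<^sub>R a) $ i \<in> \<int>" by simp
    qed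
  qed
qed

text \<open>An exposing normal may be irrational. It is replaced by a rational one orthogonal to the
  same differences of generators in \<open>G\<close> and close enough to respect the finitely many
  strict inequalities at the other generators. The bound \<open>d\<close> is real; it is an integer
  once \<open>G\<close> contains an integer point.\<close>

lemma facet_integral_normal:
  fixes L :: "(real^'m) set"
  assumes L: "rational_polytope L" and G: "G facet_of L" and f: "f \<in> interior L"
  obtains g d where "int_vec g" "\<And>x. x \<in> L \<Longrightarrow> g \<bullet> x \<le> d" "\<And>x. x \<in> G \<Longrightarrow> g \<bullet> x = d" "g \<bullet> f < d"
proof -
  obtain V where V: "finite V" "\<And>v. v \<in> V \<Longrightarrow> rat_vec v" "L = convex hull V"
    using L unfolding rational_polytope_def by blast
  have poly: "polyhedron L" using V by (simp add: polytope_convex_hull polytope_imp_polyhedron)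
  have Gf: "G face_of L" and Gne: "G \<noteq> {}" using G by (auto simp: facet_of_def)
  have GL: "G \<noteq> L" using G by (auto simp: facet_of_def)
  have "G exposed_face_of L" using Gf poly exposed_face_of_polyhedron by blast
  then obtain a b where ab: "L \<subseteq> {x. a \<bullet> x \<le> b}" "G = L \<inter> {x. a \<bullet> x = b}"
    unfolding exposed_face_of_def by blast
  obtain V' where V': "V' \<subseteq> V" "G = convex hull V'"
    using face_of_convex_hull_subset[of V G] Gf V by (auto simp: finite_imp_compact)
  have "V' \<noteq> {}" using V' Gne by auto
  then obtain v0 where v0: "v0 \<in> V'" by blast
  have v0G: "v0 \<in> G" using v0 unfolding V'(2) by (rule hull_inc)
  have VL: "V \<subseteq> L" unfolding V(3) by (rule hull_subset)
  have V'G: "V' \<subseteq> G" unfolding V'(2) by (rule hull_subset)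
  define U where "U = V - G"
  have "U \<noteq> {}"
  proof
    assume "U = {}"
    then have "V \<subseteq> G" by (auto simp: U_def)
    then have "L \<subseteq> G" unfolding V(3) using face_of_imp_convex[OF Gf] by (intro hull_minimal)
    then show False using GL Gf face_of_imp_subset by blast
  qed
  have neg: "a \<bullet> (v - v0) < 0" if "v \<in> U" for v
    using that ab VL v0G by (auto simp: U_def inner_diff_right less_le)
  have "\<exists>e>0. \<forall>v\<in>U. e * norm (v - v0) < - (a \<bullet> (v - v0))"
  proof -
    have "\<forall>v\<in>U. eventually (\<lambda>e. e * norm (v - v0) < - (a \<bullet> (v - v0))) (at_right 0)"
    proof
      fix v assume "v \<in> U"
      have "((\<lambda>e. e * norm (v - v0)) \<longlongrightarrow> 0 * norm (v - v0)) (at_right 0)"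
        by (intro tendsto_intros)
      then show "eventually (\<lambda>e. e * norm (v - v0) < - (a \<bullet> (v - v0))) (at_right 0)"
        using neg[OF \<open>v \<in> U\<close>] by (intro order_tendstoD) auto
    qed
    then have "eventually (\<lambda>e. \<forall>v\<in>U. e * norm (v - v0) < - (a \<bullet> (v - v0))) (at_right (0::real))"
      using V(1) by (subst eventually_ball_finite_distrib) (auto simp: U_def)
    then have "eventually (\<lambda>e. e > 0 \<and> (\<forall>v\<in>U. e * norm (v - v0) < - (a \<bullet> (v - v0)))) (at_right (0::real))"
      using eventually_at_right_less by eventually_elim auto
    then show ?thesis by (auto dest: eventually_happens)
  qed
  then obtain e where e: "e > 0" "\<And>v. v \<in> U \<Longrightarrow> e * norm (v - v0) < - (a \<bullet> (v - v0))" by blast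
  obtain a' where a': "rat_vec a'" "\<And>y. rat_vec y \<Longrightarrow> a \<bullet> y = 0 \<Longrightarrow> a' \<bullet> y = 0" "norm (a' - a) < e"
    using rational_approx_orthogonal[where a = a, OF e(1)] by blast
  have neg': "a' \<bullet> (v - v0) < 0" if "v \<in> U" for v
  proof -
    have "(a' - a) \<bullet> (v - v0) \<le> norm (a' - a) * norm (v - v0)" by (rule norm_cauchy_schwarz)
    also have "\<dots> \<le> e * norm (v - v0)" using a'(3) by (intro mult_right_mono) auto
    also have "\<dots> < - (a \<bullet> (v - v0))" by (rule e(2)[OF that])
    finally show ?thesis by (simp add: inner_diff_left)
  qed
  have zero': "a' \<bullet> (v - v0) = 0" if "v \<in> V \<inter> G" for v
  proof (rule a'(2))
    show "rat_vec (v - v0)" using that v0 V'(1) by (intro rat_vec_diff V(2)) auto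
    show "a \<bullet> (v - v0) = 0" using that v0G unfolding ab(2) by (simp add: inner_diff_right)
  qed
  obtain n :: nat where n: "n > 0" "int_vec (real n *\<^sub>R a')" using rat_vec_clear_denominators[OF a'(1)] .
  define g where "g = real n *\<^sub>R a'"
  have gV: "g \<bullet> v \<le> g \<bullet> v0" if "v \<in> V" for v
    using neg'[of v] zero'[of v] that n(1)
    by (cases "v \<in> G") (auto simp: g_def U_def inner_diff_right)
  have gL: "g \<bullet> x \<le> g \<bullet> v0" if "x \<in> L" for x
  proof -
    have "L \<subseteq> {x. g \<bullet> x \<le> g \<bullet> v0}"
      unfolding V(3) using gV by (intro hull_minimal convex_halfspace_le) auto
    then show ?thesis using that by blast
  qed
  show thesis
  proof (rule that)
    show "int_vec g" using n by (simp add: g_def)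
    show "g \<bullet> x \<le> g \<bullet> v0" if "x \<in> L" for x using gL that .
    show "g \<bullet> x = g \<bullet> v0" if "x \<in> G" for x
    proof -
      have "G \<subseteq> {x. g \<bullet> x = g \<bullet> v0}"
        unfolding V'(2) using zero' V' V'G
        by (intro hull_minimal convex_hyperplane) (auto simp: g_def inner_diff_right)
      then show ?thesis using that by blast
    qed
    have "g \<noteq> 0" using \<open>U \<noteq> {}\<close> neg' n(1) by (auto simp: g_def)
    have "interior L \<subseteq> interior {x. g \<bullet> x \<le> g \<bullet> v0}" using gL by (intro interior_mono) auto
    then show "g \<bullet> f < g \<bullet> v0" using f interior_halfspace_le[OF \<open>g \<noteq> 0\<close>] by auto
  qed
qed

text \<open>A half-space is convex, so it contains the hull of the two sides of a split as soon as
  it contains both.\<close>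

lemma split_closure_valid:
  assumes "\<And>x s. (x, s) \<in> Q \<Longrightarrow> a \<bullet> x \<le> of_int k \<Longrightarrow> w \<bullet> s \<le> b + v \<bullet> x"
    and "\<And>x s. (x, s) \<in> Q \<Longrightarrow> a \<bullet> x \<ge> of_int k + 1 \<Longrightarrow> w \<bullet> s \<le> b + v \<bullet> x"
    and "int_vec a" "(x, s) \<in> split_closure Q"
  shows "w \<bullet> s \<le> b + v \<bullet> x"
proof -
  have "(x, s) \<in> split_set Q a k" using assms(3,4) unfolding split_closure_def by blast
  also have "\<dots> \<subseteq> {p. (- v, w) \<bullet> p \<le> b}"
    unfolding split_set_def
    by (intro hull_minimal convex_halfspace_le) (use assms(1,2) in \<open>force simp: inner_Pair\<close>)
  finally show ?thesis by (simp add: inner_Pair)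
qed

subsection \<open>The polar of \<open>L - f\<close> and the gauge\<close>

definition polar_at :: "real^'m \<Rightarrow> (real^'m) set \<Rightarrow> (real^'m) set" where
  "polar_at f L = {g. \<forall>x\<in>L. g \<bullet> (x - f) \<le> 1}"

text \<open>Every linear functional is bounded on the bounded set \<open>L - f\<close>; hence the
  polar supplies inequalities in every direction.\<close>

lemma polar_at_absorbing:
  assumes "bounded L"
  obtains t where "t > 0" "t *\<^sub>R g \<in> polar_at f L"
proof -
  obtain B where B: "B > 0" "\<And>x. x \<in> L \<Longrightarrow> norm (x - f) \<le> B"
  proof -
    have "bounded ((\<lambda>x. x - f) ` L)" using assms by (rule bounded_translation_minus)
    then show thesis using that unfolding bounded_pos by blast
  qed
  define t where "t = 1 / (norm g * B + 1)"
  have pos: "norm g * B + 1 > 0" using B(1) by (simp add: add_nonneg_pos)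
  show thesis
  proof
    show "t > 0" using pos by (simp add: t_def)
    have "g \<bullet> (x - f) \<le> norm g * B + 1" if "x \<in> L" for x
    proof -
      have "g \<bullet> (x - f) \<le> norm g * norm (x - f)" by (rule norm_cauchy_schwarz)
      also have "\<dots> \<le> norm g * B" using B(2)[OF that] by (intro mult_left_mono) auto
      finally show ?thesis by simp
    qed
    then show "t *\<^sub>R g \<in> polar_at f L"
      using pos by (auto simp: polar_at_def t_def field_simps)
  qed
qed

lemma polar_at_of_valid:
  assumes "\<And>x. x \<in> L \<Longrightarrow> g \<bullet> x \<le> d" "g \<bullet> f < d"
  shows "(1 / (d - g \<bullet> f)) *\<^sub>R g \<in> polar_at f L"
proof -
  have "d - g \<bullet> f > 0" using assms(2) by simp
  then show ?thesis using assms(1) by (auto simp: polar_at_def divide_le_eq inner_diff_right simp flip: diff_divide_distrib)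
qed

text \<open>A hyperplane separating \<open>p\<close> from \<open>L\<close>, normalised at
  \<open>f\<close>, would be a polar element violated at \<open>p\<close>.\<close>

lemma bipolar_at:
  assumes "closed L" "convex L" "f \<in> L" "\<And>g. g \<in> polar_at f L \<Longrightarrow> g \<bullet> (p - f) \<le> 1"
  shows "p \<in> L"
proof (rule ccontr)
  assume "p \<notin> L"
  then obtain a b where ab: "a \<bullet> p < b" "\<And>x. x \<in> L \<Longrightarrow> a \<bullet> x > b"
    using separating_hyperplane_closed_point[of L p] assms by blast
  have pos: "a \<bullet> f - b > 0" using ab(2)[OF assms(3)] by simp
  have "(1 / (- b - (- a) \<bullet> f)) *\<^sub>R (- a) \<in> polar_at f L"
    using ab(2) pos by (intro polar_at_of_valid) (auto intro: less_imp_le)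
  from assms(4)[OF this] have "(a \<bullet> f - a \<bullet> p) / (a \<bullet> f - b) \<le> 1"
    by (simp add: inner_diff_right diff_divide_distrib)
  then show False using pos ab(1) by (simp add: divide_le_eq)
qed

text \<open>Every \<open>t\<close> in the set defining \<open>psi\<close> is at least
  \<open>g \<bullet> r\<close>. As \<open>f\<close> is interior this set is nonempty, without which
  \<open>Inf\<close> would carry no information.\<close>

lemma polar_at_le_psi:
  assumes g: "g \<in> polar_at f L" and f: "f \<in> interior L"
  shows "g \<bullet> r \<le> psi L f r"
  unfolding psi_def
proof (rule cInf_greatest)
  obtain e where e: "e > 0" "ball f e \<subseteq> L" using f mem_interior by blast
  \<comment> \<open>The 1 keeps \<open>t\<close> positive for \<open>r = 0\<close> and the norm of
    \<open>r / t\<close> strictly below \<open>e\<close>.\<close>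
  define t where "t = (norm r + 1) / e"
  have t: "t > 0" using e(1) by (simp add: t_def add_nonneg_pos)
  have "norm (inverse t *\<^sub>R r) < e"
    using e(1) t by (simp add: t_def field_simps add_nonneg_pos)
  then have "f + inverse t *\<^sub>R r \<in> L" using e(2) by (auto simp: dist_norm)
  then have "inverse t *\<^sub>R r \<in> (\<lambda>y. y - f) ` L" by (intro image_eqI[of _ _ "f + inverse t *\<^sub>R r"]) auto
  then show "{t. t > 0 \<and> inverse t *\<^sub>R r \<in> (\<lambda>y. y - f) ` L} \<noteq> {}" using t by blast
  show "g \<bullet> r \<le> t" if "t \<in> {t. t > 0 \<and> inverse t *\<^sub>R r \<in> (\<lambda>y. y - f) ` L}" for t
  proof -
    have "t > 0" and "\<exists>y\<in>L. inverse t *\<^sub>R r = y - f" using that by auto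
    then have "g \<bullet> (inverse t *\<^sub>R r) \<le> 1" using g unfolding polar_at_def by fastforce
    then show ?thesis using \<open>t > 0\<close> by (simp add: field_simps)
  qed
qed

subsection \<open>Inequalities reachable by split closures\<close>

text \<open>This isolates what the argument uses of \<open>P\<close> and the gauge: \<open>w\<close>
  stands for the vector of the values \<open>psi L f (r j)\<close>, and \<open>polar_bound\<close>
  ties it to \<open>L\<close>.\<close>

locale intersection_cut =
  fixes P :: "((real^'m) \<times> (real^'k)) set" and w :: "real^'k"
    and L :: "(real^'m) set" and f :: "real^'m"
  assumes bounded_L: "bounded L" and closed_L: "closed L" and convex_L: "convex L"
    and f_interior: "f \<in> interior L"
    and polar_bound: "(x, s) \<in> P \<Longrightarrow> g \<in> polar_at f L \<Longrightarrow> g \<bullet> (x - f) \<le> w \<bullet> s"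
begin

abbreviation closures :: "nat \<Rightarrow> ((real^'m) \<times> (real^'k)) set" where
  "closures t \<equiv> rank_split_closure t P"

lemma closures_Suc: "closures (Suc t) = split_closure (closures t)"
  by (simp add: rank_split_closure_def)

definition excess :: "real \<Rightarrow> real \<Rightarrow> real^'k \<Rightarrow> real" where
  "excess K M s = K * (1 - w \<bullet> s - M)"

definition holds_at :: "nat \<Rightarrow> real \<Rightarrow> real \<Rightarrow> real^'m \<Rightarrow> real \<Rightarrow> bool" where
  "holds_at t K M a b \<longleftrightarrow> (\<forall>(x, s) \<in> closures t. excess K M s \<le> b - a \<bullet> x)"

text \<open>\<open>excess K M s \<le> 1\<close> says that the height is at most \<open>M + 1 / K\<close>.  The number of rounds
  \<open>N\<close> must not depend on \<open>K\<close>, \<open>t\<close> or \<open>M\<close>, so that rounds with the same \<open>K\<close> can be chained, each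
  lowering \<open>M\<close> by \<open>1 / K\<close>.\<close>

definition reachable :: "real^'m \<Rightarrow> real \<Rightarrow> bool" where
  "reachable a b \<longleftrightarrow> (\<exists>N. \<exists>K0>0. \<forall>K\<ge>K0. \<forall>t. \<forall>M\<ge>0.
     holds_at t K M 0 1 \<longrightarrow> holds_at (t + N) K M a b)"

lemma holds_at_split:
  assumes v: "int_vec v"
    and le: "\<And>x s. (x, s) \<in> closures t \<Longrightarrow> v \<bullet> x \<le> of_int k \<Longrightarrow> excess K M s \<le> b - a \<bullet> x"
    and ge: "\<And>x s. (x, s) \<in> closures t \<Longrightarrow> v \<bullet> x \<ge> of_int k + 1 \<Longrightarrow> excess K M s \<le> b - a \<bullet> x"
  shows "holds_at (Suc t) K M a b"
proof -
  have eq: "excess K M s \<le> b - a \<bullet> x \<longleftrightarrow> (- K *\<^sub>R w) \<bullet> s \<le> (b - K * (1 - M)) + (- a) \<bullet> x" for x s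
    by (simp add: excess_def algebra_simps)
  have "excess K M s \<le> b - a \<bullet> x" if "(x, s) \<in> split_closure (closures t)" for x s
    unfolding eq
    by (rule split_closure_valid[OF _ _ v that]; unfold eq[symmetric]; fact le ge)
  then show ?thesis unfolding holds_at_def closures_Suc by blast
qed

lemma holds_at_mono:
  assumes "holds_at t K M a b" "t \<le> t'" shows "holds_at t' K M a b"
  using assms(2)
proof (induction t' rule: dec_induct)
  case (step n)
  \<comment> \<open>The trivial split, 0 <= 0 or 0 >= 1, has everything on its first side, so a
    valid bound survives one more round.\<close>
  then show ?case by (intro holds_at_split[of 0 n 0]) (auto simp: holds_at_def)
qed (rule assms)

lemma holds_at_weaken: "holds_at t K M a b \<Longrightarrow> b \<le> b' \<Longrightarrow> holds_at t K M a b'"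
  unfolding holds_at_def by fastforce

lemma closures_polar_bound:
  assumes "(x, s) \<in> closures t" "g \<in> polar_at f L"
  shows "g \<bullet> (x - f) \<le> w \<bullet> s"
proof -
  \<comment> \<open>With \<open>K = 1\<close> and \<open>M = 0\<close> the excess is the height, and
    this bound is the polar inequality itself.\<close>
  have "holds_at 0 1 0 g (1 + g \<bullet> f)"
    using polar_bound[OF _ assms(2)]
    by (fastforce simp: holds_at_def excess_def rank_split_closure_def inner_diff_right)
  then have "holds_at t 1 0 g (1 + g \<bullet> f)" by (rule holds_at_mono) simp
  then show ?thesis using assms(1) by (auto simp: holds_at_def excess_def inner_diff_right)
qed

lemma excess_le_polar:
  assumes "(x, s) \<in> closures t" "g \<in> polar_at f L" "K \<ge> 0" "M \<ge> 0"
  shows "excess K M s \<le> K * (1 - g \<bullet> (x - f))"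
  unfolding excess_def using closures_polar_bound[OF assms(1,2)] assms(3,4)
  by (intro mult_left_mono) auto

lemma reachableI:
  assumes "K0 > 0" "\<And>K t M. K \<ge> K0 \<Longrightarrow> M \<ge> 0 \<Longrightarrow> holds_at t K M 0 1 \<Longrightarrow> holds_at (t + N) K M a b"
  shows "reachable a b"
  using assms unfolding reachable_def by blast

lemma reachable_const: "reachable 0 1"
  by (rule reachableI[of 1 0]) auto

lemma reachable_weaken: "reachable a b \<Longrightarrow> b \<le> b' \<Longrightarrow> reachable a b'"
  using holds_at_weaken unfolding reachable_def by meson

text \<open>The two given bounds are \<open>b - a \<bullet> x - t1 * (k - v \<bullet> x)\<close> and
  \<open>b - a \<bullet> x - t2 * (v \<bullet> x - (k + 1))\<close>; each is at most the target on
  its own side of the split. One round after the slower of the two suffices.\<close>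

lemma reachable_split:
  assumes r1: "reachable (a - t1 *\<^sub>R v) (b - t1 * of_int k)" and t1: "t1 \<ge> 0"
    and r2: "reachable (a + t2 *\<^sub>R v) (b + t2 * (of_int k + 1))" and t2: "t2 \<ge> 0"
    and v: "int_vec v"
  shows "reachable a b"
proof -
  obtain N1 K1 where K1: "K1 > 0" and h1: "\<And>K t M. K \<ge> K1 \<Longrightarrow> M \<ge> 0 \<Longrightarrow> holds_at t K M 0 1 \<Longrightarrow>
      holds_at (t + N1) K M (a - t1 *\<^sub>R v) (b - t1 * of_int k)"
    using r1 unfolding reachable_def by blast
  obtain N2 K2 where K2: "K2 > 0" and h2: "\<And>K t M. K \<ge> K2 \<Longrightarrow> M \<ge> 0 \<Longrightarrow> holds_at t K M 0 1 \<Longrightarrow>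
      holds_at (t + N2) K M (a + t2 *\<^sub>R v) (b + t2 * (of_int k + 1))"
    using r2 unfolding reachable_def by blast
  show ?thesis
  proof (rule reachableI[of "max K1 K2" "Suc (max N1 N2)"])
    show "max K1 K2 > 0" using K1 by simp
    fix K t and M :: real assume K: "K \<ge> max K1 K2" and M: "M \<ge> 0" and base: "holds_at t K M 0 1"
    let ?T = "t + max N1 N2"
    have 1: "holds_at ?T K M (a - t1 *\<^sub>R v) (b - t1 * of_int k)"
      using h1[OF _ M base] K by (intro holds_at_mono[of "t + N1" _ _ _ _ ?T]) auto
    have 2: "holds_at ?T K M (a + t2 *\<^sub>R v) (b + t2 * (of_int k + 1))"
      using h2[OF _ M base] K by (intro holds_at_mono[of "t + N2" _ _ _ _ ?T]) auto
    have "holds_at (Suc ?T) K M a b"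
    proof (rule holds_at_split[OF v])
      fix x s assume xs: "(x, s) \<in> closures ?T"
      show "excess K M s \<le> b - a \<bullet> x" if "v \<bullet> x \<le> of_int k"
      proof -
        have "excess K M s \<le> b - t1 * of_int k - (a - t1 *\<^sub>R v) \<bullet> x"
          using 1 xs unfolding holds_at_def by auto
        also have "\<dots> = b - a \<bullet> x - t1 * (of_int k - v \<bullet> x)" by (simp add: algebra_simps)
        finally show ?thesis using mult_nonneg_nonneg[OF t1, of "of_int k - v \<bullet> x"] that by simp
      qed
      show "excess K M s \<le> b - a \<bullet> x" if "v \<bullet> x \<ge> of_int k + 1"
      proof -
        have "excess K M s \<le> b + t2 * (of_int k + 1) - (a + t2 *\<^sub>R v) \<bullet> x"
          using 2 xs unfolding holds_at_def by auto
        also have "\<dots> = b - a \<bullet> x - t2 * (v \<bullet> x - (of_int k + 1))" by (simp add: algebra_simps)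
        finally show ?thesis using mult_nonneg_nonneg[OF t2, of "v \<bullet> x - (of_int k + 1)"] that by simp
      qed
    qed
    then show "holds_at (t + Suc (max N1 N2)) K M a b" by simp
  qed
qed

text \<open>The slack \<open>e\<close> is needed for the inequalities of \<open>L\<close> itself; for integral inequalities it
  disappears again by rounding.\<close>

definition free_cone :: "((real^'m) \<times> real) set" where
  "free_cone = {(a, b). \<forall>a' b' e t. reachable a' b' \<longrightarrow> e > 0 \<longrightarrow> t \<ge> 0 \<longrightarrow>
     reachable (a' + t *\<^sub>R a) (b' + e + t * b)}"

lemma free_coneI:
  assumes "\<And>a' b' e t. reachable a' b' \<Longrightarrow> e > 0 \<Longrightarrow> t \<ge> 0 \<Longrightarrow>
     reachable (a' + t *\<^sub>R a) (b' + e + t * b)"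
  shows "(a, b) \<in> free_cone"
  using assms unfolding free_cone_def by simp

lemma free_coneD:
  "(a, b) \<in> free_cone \<Longrightarrow> reachable a' b' \<Longrightarrow> e > 0 \<Longrightarrow> t \<ge> 0 \<Longrightarrow>
     reachable (a' + t *\<^sub>R a) (b' + e + t * b)"
  unfolding free_cone_def by blast

text \<open>Split on \<open>a\<close> at \<open>k\<close>. Where
  \<open>a \<bullet> x \<le> k\<close>, the bound from \<open>r\<close> is already at most the
  target. On the other side a large multiple of the free inequality is added first.\<close>

lemma reachable_rounding:
  assumes a: "int_vec a" and e: "e > 0" and free: "(a, of_int k + 1 - e) \<in> free_cone"
    and r: "reachable a' b'" and t: "t \<ge> 0"
  shows "reachable (a' + t *\<^sub>R a) (b' + t * of_int k)"
proof -
  \<comment> \<open>The gain \<open>T * e = 1 + t\<close> pays for the slack 1 and for the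
    difference between \<open>t * (k + 1)\<close> and \<open>t * k\<close>.\<close>
  define T where "T = (1 + t) / e"
  have T: "T \<ge> 0" "T * e = 1 + t" using e t by (auto simp: T_def)
  have "reachable (a' + (t + T) *\<^sub>R a) (b' + 1 + (t + T) * (of_int k + 1 - e))"
    using T t by (intro free_coneD free r) auto
  moreover have "b' + 1 + (t + T) * (of_int k + 1 - e) \<le> b' + t * of_int k + T * (of_int k + 1)"
    using T(2) mult_nonneg_nonneg[OF t, of e] e by (simp add: algebra_simps)
  ultimately have "reachable (a' + (t + T) *\<^sub>R a) (b' + t * of_int k + T * (of_int k + 1))"
    by (rule reachable_weaken)
  then have ge: "reachable (a' + t *\<^sub>R a + T *\<^sub>R a) (b' + t * of_int k + T * (of_int k + 1))"
    by (simp add: scaleR_add_left add.assoc)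
  have le: "reachable (a' + t *\<^sub>R a - t *\<^sub>R a) (b' + t * of_int k - t * of_int k)"
    using r by simp
  show ?thesis by (rule reachable_split[OF le t ge T(1) a])
qed

text \<open>The multiplier \<open>K\<close> of the polar inequality lets its share in the convex combination tend to
  zero; the third inequality, parallel to the given one, compensates for that share up to
  an error of order \<open>1 / K\<close>.\<close>

lemma polar_free:
  assumes g: "g \<in> polar_at f L"
  shows "(g, 1 + g \<bullet> f) \<in> free_cone"
proof (rule free_coneI)
  fix a b and e t :: real assume r: "reachable a b" and e: "e > 0" and t: "t \<ge> 0"
  obtain u where u: "u > 0" "u *\<^sub>R a \<in> polar_at f L" using polar_at_absorbing[OF bounded_L, of a f] by blast
  \<comment> \<open>Chosen so that \<open>1 - (u *\<^sub>R a) \<bullet> (x - f) = q + u * (b - a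
    \<bullet> x)\<close>.\<close>
  define q where "q = 1 + u * (a \<bullet> f) - u * b"
  obtain N K1 where K1: "K1 > 0" and h: "\<And>K t M. K \<ge> K1 \<Longrightarrow> M \<ge> 0 \<Longrightarrow> holds_at t K M 0 1 \<Longrightarrow>
      holds_at (t + N) K M a b"
    using r unfolding reachable_def by blast
  \<comment> \<open>Besides making \<open>h\<close> applicable, the thresholds give in turn
    \<open>\<theta>1 \<le> 1/2\<close>, an error of at most \<open>e\<close>, and
    \<open>\<theta>2 \<le> \<theta>1\<close>.\<close>
  define K0 where "K0 = max (max K1 (2 * t + 1)) (max ((1 + t * \<bar>q\<bar> / e) / u) (2 / u))"
  show "reachable (a + t *\<^sub>R g) (b + e + t * (1 + g \<bullet> f))"
  proof (rule reachableI[of K0 N])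
    show "K0 > 0" using K1 by (simp add: K0_def)
    fix K T and M :: real assume K: "K \<ge> K0" and M: "M \<ge> 0" and base: "holds_at T K M 0 1"
    have "K \<ge> K1" "K \<ge> 2 * t + 1" "K \<ge> (1 + t * \<bar>q\<bar> / e) / u" "K \<ge> 2 / u" using K by (auto simp: K0_def)
    then have Kb: "K \<ge> K1" "K \<ge> 2 * t + 1" "K * u \<ge> 1 + t * \<bar>q\<bar> / e" "K * u \<ge> 2"
      using u(1) by (auto simp: field_simps)
    have Kpos: "K > 0" using Kb(2) t by linarith
    define \<theta>1 where "\<theta>1 = t / K"
    \<comment> \<open>This solves \<open>\<theta>2 * K * u = \<theta>1 + \<theta>2\<close>, so the
      coefficient of \<open>l\<close> in the convex combination below is exactly 1.\<close>
    define \<theta>2 where "\<theta>2 = \<theta>1 / (K * u - 1)"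
    have \<theta>: "\<theta>1 \<ge> 0" "\<theta>2 \<ge> 0" using t Kpos Kb(4) by (auto simp: \<theta>1_def \<theta>2_def)
    have "\<theta>1 \<le> 1/2" using Kpos Kb(2) by (simp add: \<theta>1_def field_simps)
    moreover have "\<theta>2 \<le> \<theta>1"
      using Kb(4) \<theta>(1) mult_left_mono[of 1 "K * u - 1" \<theta>1] by (simp add: \<theta>2_def field_simps)
    ultimately have \<theta>sum: "\<theta>1 + \<theta>2 \<le> 1" by simp
    have \<theta>1K: "\<theta>1 * K = t" using Kpos by (simp add: \<theta>1_def)
    have \<theta>2K: "\<theta>2 * K * u = \<theta>1 + \<theta>2" using Kb(4) by (simp add: \<theta>2_def field_simps)
    have err: "\<theta>2 * K * q \<le> e"
    proof -
      have pos: "K * u - 1 > 0" using Kb(4) by simp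
      have "t * \<bar>q\<bar> / e \<le> K * u - 1" using Kb(3) by simp
      then have "t * \<bar>q\<bar> \<le> e * (K * u - 1)" using e by (simp only: pos_divide_le_eq mult.commute)
      then have "t * \<bar>q\<bar> / (K * u - 1) \<le> e" using pos by (simp only: pos_divide_le_eq)
      have "\<theta>2 * K = t / (K * u - 1)" by (simp add: \<theta>2_def flip: \<theta>1K)
      then have "\<theta>2 * K * q = t * q / (K * u - 1)" by simp
      also have "\<dots> \<le> t * \<bar>q\<bar> / (K * u - 1)"
        using pos t by (intro divide_right_mono mult_left_mono) auto
      also have "\<dots> \<le> e" by fact
      finally show ?thesis .
    qed
    have "excess K M s \<le> b + e + t * (1 + g \<bullet> f) - (a + t *\<^sub>R g) \<bullet> x"
      if xs: "(x, s) \<in> closures (T + N)" for x s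
    proof -
      define l where "l = b - a \<bullet> x"
      define d where "d = 1 - g \<bullet> (x - f)"
      let ?z = "excess K M s"
      have 1: "?z \<le> l" using h[OF Kb(1) M base] xs by (auto simp: holds_at_def l_def)
      have 2: "?z \<le> K * d" unfolding d_def using Kpos by (intro excess_le_polar[OF xs g _ M]) simp
      have "?z \<le> K * (1 - (u *\<^sub>R a) \<bullet> (x - f))"
        using Kpos by (intro excess_le_polar[OF xs u(2) _ M]) simp
      also have "1 - (u *\<^sub>R a) \<bullet> (x - f) = q + u * l" by (simp add: q_def l_def algebra_simps inner_diff_right)
      finally have 3: "?z \<le> K * (q + u * l)" .
      have "?z = (1 - \<theta>1 - \<theta>2) * ?z + \<theta>1 * ?z + \<theta>2 * ?z" by (simp add: algebra_simps)
      also have "\<dots> \<le> (1 - \<theta>1 - \<theta>2) * l + \<theta>1 * (K * d) + \<theta>2 * (K * (q + u * l))"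
        using \<theta> \<theta>sum 1 2 3 by (intro add_mono mult_left_mono) auto
      also have "\<dots> = l + (\<theta>1 * K) * d + \<theta>2 * K * q + (\<theta>2 * K * u - (\<theta>1 + \<theta>2)) * l"
        by (simp add: algebra_simps)
      also have "\<dots> \<le> l + t * d + e" using err unfolding \<theta>1K \<theta>2K by simp
      finally show ?thesis by (simp add: l_def d_def algebra_simps inner_diff_right)
    qed
    then show "holds_at (T + N) K M (a + t *\<^sub>R g) (b + e + t * (1 + g \<bullet> f))"
      by (auto simp: holds_at_def)
  qed
qed

lemma scale_free:
  assumes "p \<in> free_cone" "u \<ge> 0" shows "u *\<^sub>R p \<in> free_cone"
proof -
  obtain a b where p: "p = (a, b)" by (cases p)
  have "(u *\<^sub>R a, u * b) \<in> free_cone"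
  proof (rule free_coneI)
    fix a' b' and e t :: real assume "reachable a' b'" "e > 0" "t \<ge> 0"
    then show "reachable (a' + t *\<^sub>R (u *\<^sub>R a)) (b' + e + t * (u * b))"
      using free_coneD[of a b a' b' e "t * u"] assms by (simp add: p mult.assoc)
  qed
  then show ?thesis by (simp add: p)
qed

lemma rounding_cone_free: "rounding_cone free_cone"
proof
  show "(0, b) \<in> free_cone" if "b \<ge> 0" for b
    using that by (intro free_coneI) (auto elim!: reachable_weaken)
  show "p + q \<in> free_cone" if p: "p \<in> free_cone" and q: "q \<in> free_cone" for p q
  proof -
    obtain a b c d where pq: "p = (a, b)" "q = (c, d)" by (cases p, cases q)
    have "(a + c, b + d) \<in> free_cone"
    proof (rule free_coneI)
      fix a' b' and e t :: real assume r: "reachable a' b'" and e: "e > 0" and t: "t \<ge> 0"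
      have "reachable (a' + t *\<^sub>R a + t *\<^sub>R c) (b' + e/2 + t * b + e/2 + t * d)"
        using p q e t by (intro free_coneD r) (auto simp: pq)
      moreover have "b' + e/2 + t * b + e/2 + t * d = b' + e + t * (b + d)"
        by (simp add: algebra_simps)
      moreover have "a' + t *\<^sub>R a + t *\<^sub>R c = a' + t *\<^sub>R (a + c)" by (simp add: algebra_simps)
      ultimately show "reachable (a' + t *\<^sub>R (a + c)) (b' + e + t * (b + d))" by (simp only:)
    qed
    then show ?thesis by (simp add: pq)
  qed
  show "u *\<^sub>R p \<in> free_cone" if "p \<in> free_cone" "u \<ge> 0" for p u using that by (rule scale_free)
  show "\<exists>b. (a, b) \<in> free_cone" for a
  proof -
    obtain u where u: "u > 0" "u *\<^sub>R a \<in> polar_at f L" using polar_at_absorbing[OF bounded_L, of a f] by blast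
    have "(1/u) *\<^sub>R (u *\<^sub>R a, 1 + (u *\<^sub>R a) \<bullet> f) \<in> free_cone"
      using u by (intro scale_free polar_free) auto
    then show ?thesis using u(1) by auto
  qed
  show "(a, of_int k) \<in> free_cone"
    if "int_vec a" "e > 0" "(a, of_int k + 1 - e) \<in> free_cone" for a e k
    by (rule free_coneI, rule reachable_weaken[OF reachable_rounding[OF that]]) auto
qed

text \<open>An integer point obeying the free cone obeys the polar, hence lies in \<open>L\<close>;
  Chvatal's theorem for the cone then applies.\<close>

lemma valid_integral_free:
  assumes a: "int_vec a" and valid: "\<And>p. p \<in> integer_points L \<Longrightarrow> a \<bullet> p \<le> of_int k"
  shows "(a, of_int k) \<in> free_cone"
proof (rule rounding_cone.integral_valid_mem[OF rounding_cone_free a])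
  fix p :: "real^'m" assume p: "int_vec p" and free: "\<forall>(c, d)\<in>free_cone. c \<bullet> p \<le> d"
  have "p \<in> L"
  proof (rule bipolar_at[OF closed_L convex_L])
    show "f \<in> L" using f_interior interior_subset by blast
    show "g \<bullet> (p - f) \<le> 1" if "g \<in> polar_at f L" for g
      using polar_free[OF that] free by (auto simp: inner_diff_right)
  qed
  then show "a \<bullet> p \<le> of_int k" using p valid by (simp add: integer_points_def)
qed

lemma reachable_add_valid:
  assumes a: "int_vec a" and valid: "\<And>p. p \<in> integer_points L \<Longrightarrow> a \<bullet> p \<le> of_int k"
    and "reachable a' b'" "t \<ge> 0"
  shows "reachable (a' + t *\<^sub>R a) (b' + t * of_int k)"
\<comment> \<open>Rounding with \<open>e = 1\<close> leaves the bound \<open>k\<close> unchanged and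
  removes the slack.\<close>
proof (rule reachable_rounding[OF a zero_less_one _ assms(3,4)])
  show "(a, of_int k + 1 - 1) \<in> free_cone" using valid_integral_free[OF a valid] by simp
qed

text \<open>Split on \<open>g\<close> between \<open>d - 1\<close> and \<open>d\<close>. On the
  lower side the starting bound 1 is at most \<open>d - g \<bullet> x\<close>. On the upper side
  \<open>d - g \<bullet> x\<close> is nonpositive, and the polar wall, with slope factor
  \<open>K / c \<ge> 1\<close>, lies below it.\<close>

lemma reachable_facet:
  assumes g: "int_vec g" and valid: "\<And>x. x \<in> L \<Longrightarrow> g \<bullet> x \<le> of_int d" and f: "g \<bullet> f < of_int d"
  shows "reachable g (of_int d)"
proof (rule reachableI[of "of_int d - g \<bullet> f" 1])
  define c where "c = of_int d - g \<bullet> f"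
  have c: "c > 0" using f by (simp add: c_def)
  then show "of_int d - g \<bullet> f > 0" by (simp add: c_def)
  have polar: "(1 / c) *\<^sub>R g \<in> polar_at f L" unfolding c_def using valid f by (rule polar_at_of_valid)
  fix K t and M :: real assume K: "K \<ge> of_int d - g \<bullet> f" and M: "M \<ge> 0" and base: "holds_at t K M 0 1"
  have "holds_at (Suc t) K M g (of_int d)"
  proof (rule holds_at_split[OF g, of t "d - 1"])
    fix x s assume xs: "(x, s) \<in> closures t"
    show "excess K M s \<le> of_int d - g \<bullet> x" if "g \<bullet> x \<le> of_int (d - 1)"
    proof -
      have "excess K M s \<le> 1" using base xs by (auto simp: holds_at_def)
      then show ?thesis using that by simp
    qed
    show "excess K M s \<le> of_int d - g \<bullet> x" if "g \<bullet> x \<ge> of_int (d - 1) + 1"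
    proof -
      have "excess K M s \<le> K * (1 - ((1 / c) *\<^sub>R g) \<bullet> (x - f))"
        using K c by (intro excess_le_polar[OF xs polar _ M]) (simp add: c_def)
      also have "((1 / c) *\<^sub>R g) \<bullet> (x - f) = (c - (of_int d - g \<bullet> x)) / c"
        by (simp add: c_def inner_diff_right diff_divide_distrib)
      also have "K * (1 - (c - (of_int d - g \<bullet> x)) / c) = (K / c) * (of_int d - g \<bullet> x)"
        using c by (simp add: field_simps)
      also have "\<dots> \<le> 1 * (of_int d - g \<bullet> x)"
        using that K c by (intro mult_right_mono_neg) (auto simp: c_def)
      finally show ?thesis by simp
    qed
  qed
  then show "holds_at (t + 1) K M g (of_int d)" by simp
qed

text \<open>For one fixed \<open>K\<close>, each block of \<open>N\<close> rounds lowers the bound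
  on the height by \<open>1 / K\<close>, so \<open>K\<close> blocks, rounded up, lead from 1 to
  0.\<close>

lemma reachable_zero_imp_finite_rank:
  assumes "reachable 0 0" and le1: "\<And>x s. (x, s) \<in> P \<Longrightarrow> w \<bullet> s \<ge> 0"
  obtains t where "\<And>x s. (x, s) \<in> closures t \<Longrightarrow> w \<bullet> s \<ge> 1"
proof -
  obtain N K where K: "K > 0" and h: "\<And>t M. M \<ge> 0 \<Longrightarrow> holds_at t K M 0 1 \<Longrightarrow> holds_at (t + N) K M 0 0"
    using assms(1) unfolding reachable_def by blast
  \<comment> \<open>The \<open>max 0\<close> keeps the level \<open>M\<close> nonnegative, as
    \<open>reachable\<close> demands.\<close>
  have step: "\<forall>(x, s) \<in> closures (j * N). 1 - w \<bullet> s \<le> max 0 (1 - real j / K)" for j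
  proof (induction j)
    case 0
    then show ?case using le1 by (auto simp: rank_split_closure_def)
  next
    case (Suc j)
    define M where "M = max 0 (1 - real (Suc j) / K)"
    have "real (Suc j) / K = real j / K + 1 / K" by (simp add: add_divide_distrib)
    moreover have "1 / K > 0" using K by simp
    ultimately have "max 0 (1 - real j / K) \<le> M + 1 / K" unfolding M_def by linarith
    then have "1 - w \<bullet> s - M \<le> 1 / K" if "(x, s) \<in> closures (j * N)" for x s
      using Suc that by fastforce
    then have "holds_at (j * N) K M 0 1"
      using K by (auto simp: holds_at_def excess_def field_simps)
    then have "holds_at (j * N + N) K M 0 0" by (intro h) (simp add: M_def)
    then have "\<forall>(x, s) \<in> closures (j * N + N). 1 - w \<bullet> s \<le> M"
      using K by (auto simp: holds_at_def excess_def mult_le_0_iff)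
    then show ?case by (simp add: M_def add.commute)
  qed
  define j where "j = nat \<lceil>K\<rceil>"
  have "K \<le> real j" unfolding j_def by linarith
  then have "1 - real j / K \<le> 0" using K by simp
  then have "max 0 (1 - real j / K) = 0" by simp
  then show thesis using that[of "j * N"] step[of j] by auto
qed

end

subsection \<open>Faces of the integer hull\<close>

text \<open>Integrality makes \<open>k - a \<bullet> p\<close> at least 1 off the face, so any
  \<open>T\<close> above all values \<open>\<bar>h p\<bar>\<close> works. Adding such multiples
  makes inequalities that are controlled on the face valid at all integer points.\<close>

lemma dominating_multiple:
  assumes "finite I" "int_vec a" "\<And>p. p \<in> I \<Longrightarrow> int_vec p" "\<And>p. p \<in> I \<Longrightarrow> a \<bullet> p \<le> of_int k"
  obtains T :: nat where "\<And>p. p \<in> I \<Longrightarrow> a \<bullet> p \<noteq> of_int k \<Longrightarrow> h p \<le> real T * (of_int k - a \<bullet> p)"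
proof -
  define T where "T = nat \<lceil>\<Sum>p\<in>I. \<bar>h p\<bar>\<rceil>"
  show thesis
  proof
    fix p assume p: "p \<in> I" "a \<bullet> p \<noteq> of_int k"
    obtain j :: int where j: "a \<bullet> p = of_int j"
      using inner_int_vec[OF assms(2) assms(3)[OF p(1)]] by (auto elim: Ints_cases)
    have "j < k" using assms(4)[OF p(1)] p(2) j by simp
    then have gap: "of_int k - a \<bullet> p \<ge> 1" using j by simp
    have "h p \<le> \<bar>h p\<bar>" by simp
    also have "\<dots> \<le> (\<Sum>p\<in>I. \<bar>h p\<bar>)" using p(1) assms(1) by (intro member_le_sum) auto
    also have "\<dots> \<le> real T" unfolding T_def by linarith
    also have "\<dots> \<le> real T * (of_int k - a \<bullet> p)" using mult_left_mono[OF gap, of "real T"] by simp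
    finally show "h p \<le> real T * (of_int k - a \<bullet> p)" .
  qed
qed

lemma finite_integer_points:
  fixes L :: "(real^'m) set"
  assumes "bounded L" shows "finite (integer_points L)"
proof -
  obtain B where B: "\<And>x. x \<in> L \<Longrightarrow> norm x \<le> B" using assms unfolding bounded_iff by blast
  let ?S = "real_of_int ` {- \<lceil>B\<rceil> .. \<lceil>B\<rceil>}"
  have "integer_points L \<subseteq> vec_lambda ` (UNIV \<rightarrow>\<^sub>E ?S)"
  proof
    fix x assume x: "x \<in> integer_points L"
    have "x $ i \<in> ?S" for i
    proof -
      obtain k :: int where k: "x $ i = of_int k"
        using x by (auto simp: integer_points_def int_vec_def elim: Ints_cases)
      have "\<bar>x $ i\<bar> \<le> B" using B[of x] component_le_norm_cart[of x i] x
        by (auto simp: integer_points_def)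
      then have "k \<in> {- \<lceil>B\<rceil> .. \<lceil>B\<rceil>}" unfolding k by (auto; linarith)
      then show ?thesis unfolding k by blast
    qed
    then show "x \<in> vec_lambda ` (UNIV \<rightarrow>\<^sub>E ?S)"
      by (intro image_eqI[of _ _ "($) x"]) auto
  qed
  moreover have "finite (UNIV \<rightarrow>\<^sub>E ?S :: ('m \<Rightarrow> real) set)" by (intro finite_PiE) auto
  ultimately show ?thesis using finite_subset by blast
qed

context intersection_cut
begin

lemma reachable_multiple:
  assumes rat: "rational_polytope L" and free: "lattice_free L" and two: "two_hyperplane_property L"
    and a: "int_vec a" and valid: "\<And>p. p \<in> integer_points L \<Longrightarrow> a \<bullet> p \<le> of_int k"
  shows "\<exists>t\<ge>0. reachable (t *\<^sub>R a) (t * of_int k)"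
  using a valid
proof (induction "card {p \<in> integer_points L. a \<bullet> p = of_int k}" arbitrary: a k rule: less_induct)
  case (less a k)
  note a = less.prems(1) and valid = less.prems(2)
  let ?I = "integer_points L"
  define F where "F = {p \<in> ?I. a \<bullet> p = of_int k}"
  have finI: "finite ?I" by (rule finite_integer_points[OF bounded_L])
  have intI: "int_vec p" if "p \<in> ?I" for p using that by (simp add: integer_points_def)
  have finF: "finite F" using finI by (simp add: F_def)
  show ?case
  proof (cases "F = {}")
    case True
    \<comment> \<open>No integer point attains \<open>k\<close>, so integrality improves the bound
      to \<open>k - 1\<close>; adding this to the constant bound 1 gives \<open>k\<close>.\<close>
    have "a \<bullet> p \<le> of_int (k - 1)" if pI: "p \<in> ?I" for p
    proof -
      obtain j :: int where j: "a \<bullet> p = of_int j"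
        using inner_int_vec[OF a intI[OF pI]] by (auto elim: Ints_cases)
      have "a \<bullet> p \<noteq> of_int k" using True pI by (auto simp: F_def)
      then show ?thesis using valid[OF pI] unfolding j by simp
    qed
    from reachable_add_valid[OF a this reachable_const, of 1]
    have "reachable (1 *\<^sub>R a) (1 * of_int k)" by simp
    then show ?thesis using zero_le_one by blast
  next
    case False
    define Fc where "Fc = integer_hull L \<inter> {x. a \<bullet> x = of_int k}"
    have hull_valid: "a \<bullet> x \<le> of_int k" if "x \<in> integer_hull L" for x
    proof -
      have "integer_hull L \<subseteq> {x. a \<bullet> x \<le> of_int k}"
        unfolding integer_hull_def using valid by (intro hull_minimal convex_halfspace_le) auto
      then show ?thesis using that by blast
    qed
    have face: "Fc face_of integer_hull L"
      unfolding Fc_def using hull_valid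
      by (intro face_of_Int_supporting_hyperplane_le) (auto simp: integer_hull_def)
    have hull_L: "integer_hull L \<subseteq> L"
      unfolding integer_hull_def using convex_L by (intro hull_minimal) (auto simp: integer_points_def)
    have ipF: "integer_points Fc = F"
      using hull_L unfolding F_def Fc_def integer_points_def integer_hull_def
      by (auto intro!: hull_inc)
    have FcF: "Fc = convex hull F"
    proof -
      obtain S where S: "S \<subseteq> ?I" "Fc = convex hull S"
        using face_of_convex_hull_subset[of ?I Fc] face finite_imp_compact[OF finI]
        unfolding integer_hull_def by blast
      have "S \<subseteq> Fc" unfolding S(2) by (rule hull_subset)
      then have "S \<subseteq> F" using S(1) by (auto simp: F_def Fc_def)
      then have "Fc \<subseteq> convex hull F" unfolding S(2) by (rule hull_mono)
      moreover have "convex hull F \<subseteq> Fc"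
        using ipF face_of_imp_convex[OF face] by (intro hull_minimal) (auto simp: integer_points_def)
      ultimately show ?thesis by blast
    qed
    show ?thesis
    proof (cases "\<exists>G. G facet_of L \<and> Fc \<subseteq> G")
      case True
      then obtain G where G: "G facet_of L" "Fc \<subseteq> G" by blast
      obtain g d where g: "int_vec g" "\<And>x. x \<in> L \<Longrightarrow> g \<bullet> x \<le> d" "\<And>x. x \<in> G \<Longrightarrow> g \<bullet> x = d" "g \<bullet> f < d"
        using facet_integral_normal[OF rat G(1) f_interior] by blast
      have FG: "F \<subseteq> G" using G(2) ipF by (auto simp: integer_points_def)
      obtain p where p: "p \<in> F" using False by blast
      have "g \<bullet> p \<in> \<int>" using p g(1) intI by (intro inner_int_vec) (auto simp: F_def)
      then obtain j :: int where j: "d = of_int j" using g(3) p FG by (auto elim: Ints_cases)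
      have rg: "reachable g (of_int j)" using g by (intro reachable_facet) (auto simp: j)
      \<comment> \<open>This \<open>T\<close> makes
        \<open>(T *\<^sub>R a - g) \<bullet> p \<le> T * k - j\<close> valid at all integer points;
        added to the wall \<open>g\<close> it leaves a multiple of \<open>a\<close>.\<close>
      obtain T :: nat where T: "\<And>p. p \<in> ?I \<Longrightarrow> a \<bullet> p \<noteq> of_int k \<Longrightarrow>
          of_int j - g \<bullet> p \<le> real T * (of_int k - a \<bullet> p)"
        using dominating_multiple[OF finI a intI valid, of "\<lambda>p. of_int j - g \<bullet> p"] by blast
      have "(real T *\<^sub>R a - g) \<bullet> p \<le> of_int (int T * k - j)" if "p \<in> ?I" for p
      proof (cases "a \<bullet> p = of_int k")
        case True
        then have "g \<bullet> p = of_int j" using that FG g(3) j by (auto simp: F_def)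
        then show ?thesis using True by (simp add: inner_diff_left)
      next
        case False
        then show ?thesis using T[OF that] by (simp add: algebra_simps)
      qed
      from reachable_add_valid[OF _ this rg, of 1]
      have "reachable (real T *\<^sub>R a) (real T * of_int k)"
        using a g(1) by (simp add: int_vec_diff int_vec_scaleR)
      then show ?thesis using of_nat_0_le_iff by blast
    next
      case no_facet: False
      then have "two_partitionable F"
        using two face ipF unfolding two_hyperplane_property_def by metis
      \<comment> \<open>A lone integer point is not interior to the lattice-free \<open>L\<close>,
        so it lies in a facet, contrary to \<open>no_facet\<close>.\<close>
      moreover have "\<not> (\<exists>p. F = {p})"
      proof
        assume "\<exists>p. F = {p}"
        then obtain p where p: "F = {p}" by blast
        then have pI: "p \<in> ?I" by (auto simp: F_def)
        then have "p \<notin> interior L" using free by (auto simp: lattice_free_def integer_points_def)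
        moreover have "interior L = rel_interior L"
          using f_interior by (intro rel_interior_nonempty_interior[symmetric]) auto
        ultimately have "p \<in> L - rel_interior L" using pI by (auto simp: integer_points_def)
        moreover have "polyhedron L"
          using rat unfolding rational_polytope_def
          by (auto simp: polytope_convex_hull polytope_imp_polyhedron)
        ultimately obtain G where "G facet_of L" "p \<in> G" using rel_boundary_of_polyhedron by blast
        moreover have "Fc = {p}" unfolding FcF p by simp
        ultimately show False using no_facet by blast
      qed
      ultimately obtain A B v and c :: int where AB: "A \<noteq> {}" "B \<noteq> {}" "A \<union> B = F" "A \<inter> B = {}"
        and v: "int_vec v" and A: "A \<subseteq> {x. v \<bullet> x = of_int c}" and B: "B \<subseteq> {x. v \<bullet> x = of_int c + 1}"
        using False unfolding two_partitionable_def by blast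
      \<comment> \<open>The margin keeps both slacks below positive off \<open>F\<close>.\<close>
      obtain T :: nat where T: "\<And>p. p \<in> ?I \<Longrightarrow> a \<bullet> p \<noteq> of_int k \<Longrightarrow>
          \<bar>v \<bullet> p - of_int c\<bar> + 2 \<le> real T * (of_int k - a \<bullet> p)"
        using dominating_multiple[OF finI a intI valid, of "\<lambda>p. \<bar>v \<bullet> p - of_int c\<bar> + 2"] by blast
      have on_F: "p \<in> A \<or> p \<in> B" if "p \<in> ?I" "a \<bullet> p = of_int k" for p
        using that AB(3) by (auto simp: F_def)
      \<comment> \<open>On \<open>F\<close> the slack of \<open>(a1, k1)\<close> is 0 on
        \<open>A\<close> and 1 on \<open>B\<close>, and that of \<open>(a2, k2)\<close> is 1 on
        \<open>A\<close> and 0 on \<open>B\<close>; so both zero sets are smaller than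
        \<open>F\<close>.\<close>
      define a1 where "a1 = real T *\<^sub>R a - v"
      define k1 where "k1 = int T * k - c"
      define a2 where "a2 = real T *\<^sub>R a + v"
      define k2 where "k2 = int T * k + (c + 1)"
      have slack1: "of_int k1 - a1 \<bullet> p = real T * (of_int k - a \<bullet> p) + (v \<bullet> p - of_int c)" for p
        by (simp add: a1_def k1_def algebra_simps)
      have slack2: "of_int k2 - a2 \<bullet> p = real T * (of_int k - a \<bullet> p) - (v \<bullet> p - of_int c) + 1" for p
        by (simp add: a2_def k2_def algebra_simps)
      have off1: "of_int k1 - a1 \<bullet> p > 0" if "p \<in> ?I" "a \<bullet> p \<noteq> of_int k" for p
        using T[OF that] unfolding slack1 by linarith
      have off2: "of_int k2 - a2 \<bullet> p > 0" if "p \<in> ?I" "a \<bullet> p \<noteq> of_int k" for p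
        using T[OF that] unfolding slack2 by linarith
      have valid1: "a1 \<bullet> p \<le> of_int k1" if "p \<in> ?I" for p
        using off1[OF that] on_F[OF that] slack1[of p] A B by (cases "a \<bullet> p = of_int k") auto
      have valid2: "a2 \<bullet> p \<le> of_int k2" if "p \<in> ?I" for p
        using off2[OF that] on_F[OF that] slack2[of p] A B by (cases "a \<bullet> p = of_int k") auto
      have zero1: "{p \<in> ?I. a1 \<bullet> p = of_int k1} \<subseteq> A"
      proof
        fix p assume p: "p \<in> {p \<in> ?I. a1 \<bullet> p = of_int k1}"
        then have "a \<bullet> p = of_int k" using off1[of p] by fastforce
        then show "p \<in> A" using p on_F[of p] slack1[of p] B by auto
      qed
      have zero2: "{p \<in> ?I. a2 \<bullet> p = of_int k2} \<subseteq> B"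
      proof
        fix p assume p: "p \<in> {p \<in> ?I. a2 \<bullet> p = of_int k2}"
        then have "a \<bullet> p = of_int k" using off2[of p] by fastforce
        then show "p \<in> B" using p on_F[of p] slack2[of p] A by auto
      qed
      have "\<exists>t\<ge>0. reachable (t *\<^sub>R a1) (t * of_int k1)"
      proof (rule less.hyps)
        show "card {p \<in> ?I. a1 \<bullet> p = of_int k1} < card {p \<in> ?I. a \<bullet> p = of_int k}"
          using zero1 AB finF unfolding F_def[symmetric] by (intro psubset_card_mono) auto
        show "int_vec a1" unfolding a1_def using a v by (intro int_vec_diff int_vec_scaleR) auto
      qed (rule valid1)
      then obtain t1 where t1: "t1 \<ge> 0" "reachable (t1 *\<^sub>R a1) (t1 * of_int k1)" by blast
      have "\<exists>t\<ge>0. reachable (t *\<^sub>R a2) (t * of_int k2)"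
      proof (rule less.hyps)
        show "card {p \<in> ?I. a2 \<bullet> p = of_int k2} < card {p \<in> ?I. a \<bullet> p = of_int k}"
          using zero2 AB finF unfolding F_def[symmetric] by (intro psubset_card_mono) auto
        show "int_vec a2" unfolding a2_def using a v by (intro int_vec_add int_vec_scaleR) auto
      qed (rule valid2)
      then obtain t2 where t2: "t2 \<ge> 0" "reachable (t2 *\<^sub>R a2) (t2 * of_int k2)" by blast
      \<comment> \<open>Each bound receives the multiple of \<open>a\<close> that it lacks, so that
        both get the common coefficient \<open>t\<close> required by
        \<open>reachable_split\<close>.\<close>
      define t where "t = (t1 + t2) * real T"
      have "reachable (t1 *\<^sub>R a1 + (t2 * real T) *\<^sub>R a) (t1 * of_int k1 + t2 * real T * of_int k)"
        using t1 t2 by (intro reachable_add_valid a valid) auto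
      also have "t1 *\<^sub>R a1 + (t2 * real T) *\<^sub>R a = t *\<^sub>R a - t1 *\<^sub>R v"
        by (simp add: a1_def t_def algebra_simps)
      also have "t1 * of_int k1 + t2 * real T * of_int k = t * of_int k - t1 * of_int c"
        by (simp add: k1_def t_def algebra_simps)
      finally have le: "reachable (t *\<^sub>R a - t1 *\<^sub>R v) (t * of_int k - t1 * of_int c)" .
      have "reachable (t2 *\<^sub>R a2 + (t1 * real T) *\<^sub>R a) (t2 * of_int k2 + t1 * real T * of_int k)"
        using t1 t2 by (intro reachable_add_valid a valid) auto
      also have "t2 *\<^sub>R a2 + (t1 * real T) *\<^sub>R a = t *\<^sub>R a + t2 *\<^sub>R v"
        by (simp add: a2_def t_def algebra_simps)
      also have "t2 * of_int k2 + t1 * real T * of_int k = t * of_int k + t2 * (of_int c + 1)"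
        by (simp add: k2_def t_def algebra_simps)
      finally have ge: "reachable (t *\<^sub>R a + t2 *\<^sub>R v) (t * of_int k + t2 * (of_int c + 1))" .
      have "t \<ge> 0" using t1 t2 by (simp add: t_def)
      moreover have "reachable (t *\<^sub>R a) (t * of_int k)"
        by (rule reachable_split[OF le t1(1) ge t2(1) v])
      ultimately show ?thesis by blast
    qed
  qed
qed

end

section \<open>Finite split rank of the cut\<close>

theorem theorem3:
  fixes f :: "real^'m"
    and r :: "'k::finite \<Rightarrow> real^'m"
    and L :: "(real^'m) set"
  assumes "rat_vec f" and "\<not> int_vec f"
    and "\<forall>j. rat_vec (r j) \<and> r j \<noteq> 0"
    and "{(x, s). int_vec x \<and> (\<forall>j. s $ j \<ge> 0) \<and> x = f + (\<Sum>j\<in>UNIV. s $ j *\<^sub>R r j)} \<noteq> {}"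
    and "rational_polytope L" and "lattice_free L" and "f \<in> interior L"
    and "two_hyperplane_property L"
  shows "finite_split_rank (\<lambda>j. psi L f (r j))
           {(x, s). (\<forall>j. s $ j \<ge> 0) \<and> x = f + (\<Sum>j\<in>UNIV. s $ j *\<^sub>R r j)}"
proof -
  define P :: "((real^'m) \<times> (real^'k)) set"
    where "P = {(x, s). (\<forall>j. s $ j \<ge> 0) \<and> x = f + (\<Sum>j\<in>UNIV. s $ j *\<^sub>R r j)}"
  define w :: "real^'k" where "w = (\<chi> j. psi L f (r j))"
  have poly: "polytope L"
    using assms(5) by (auto simp: rational_polytope_def polytope_convex_hull)
  have polar: "g \<bullet> (x - f) \<le> w \<bullet> s" if xs: "(x, s) \<in> P" and g: "g \<in> polar_at f L" for x s g
  proof -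
    have "g \<bullet> (x - f) = (\<Sum>j\<in>UNIV. s $ j * (g \<bullet> r j))"
      using xs by (simp add: P_def inner_sum_right)
    also have "\<dots> \<le> (\<Sum>j\<in>UNIV. s $ j * psi L f (r j))"
      using xs polar_at_le_psi[OF g assms(7)] by (intro sum_mono mult_left_mono) (auto simp: P_def)
    also have "\<dots> = w \<bullet> s" by (simp add: w_def inner_vec_def mult.commute)
    finally show ?thesis .
  qed
  interpret intersection_cut P w L f
    using poly assms(7) polar
    by unfold_locales (auto intro: polytope_imp_bounded polytope_imp_closed polytope_imp_convex)
  obtain t where "reachable (t *\<^sub>R 0) (t * of_int 0)"
    using reachable_multiple[OF assms(5,6,8), of 0 0] by auto
  then have "reachable 0 0" by simp
  moreover have "w \<bullet> s \<ge> 0" if "(x, s) \<in> P" for x s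
    using polar[OF that, of 0] by (simp add: polar_at_def)
  ultimately obtain t where t: "\<And>x s. (x, s) \<in> closures t \<Longrightarrow> w \<bullet> s \<ge> 1"
    using reachable_zero_imp_finite_rank by blast
  have "(\<Sum>j\<in>UNIV. psi L f (r j) * s $ j) = w \<bullet> s" for s
    by (simp add: w_def inner_vec_def)
  then show ?thesis
    unfolding finite_split_rank_def P_def[symmetric] using t by (intro exI[of _ t]) auto
qed

end
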